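(* Let $(R,P_\Omega)$ be a multiple Rota-Baxter algebra of pair weight $(\lambda_\Omega,\lambda_\Omega)$ and let $X$ be a set. Let $\widetilde F(X)=\{\sum_{x\in X}r_xx\mid r_x\in R\}$ be the free left $R$-module on $X$ (finite sums), with operators $\widetilde{\mathfrak{p}}_\omega:\widetilde F(X)\to\widetilde F(X)$, $\sum_{x\in X}r_xx\mapsto\sum_{x\in X}P_\omega(r_x)x$, for $\omega\in\Omega$. Then: (a) $(\widetilde F(X),\widetilde{\mathfrak{p}}_\Omega)$ is a left $(R,P_\Omega)$-module. (b) $(\widetilde F(X),\widetilde{\mathfrak{p}}_\Omega)$, equipped with the natural embedding $j:X\to\widetilde F(X)$, is the restricted free left $(R,P_\Omega)$-module on $X$.
   Context: $\mathbf{k}$ is a commutative unital ring; algebras are associative unital $\mathbf{k}$-algebras, modules are unital, "linear" means $\mathbf{k}$-linear. $\Omega$ is a nonempty set and $\lambda_\Omega=(\lambda_\omega)_{\omega\in\Omega}$ a family of elements of $\mathbf{k}$. A multiple Rota-Baxter algebra $(R,P_\Omega)$ of pair weight $(\lambda_\Omega,\lambda_\Omega)$ is an algebra $R$ with linear operators $P_\omega:R\to R$ ($\omega\in\Omega$) such that $P_\alpha(r)P_\beta(s)=P_\alpha(rP_\beta(s))+P_\beta(P_\alpha(r)s)+\lambda_\beta P_\alpha(rs)+\lambda_\alpha P_\beta(rs)$ for all $r,s\in R$, $\alpha,\beta\in\Omega$. A left $(R,P_\Omega)$-module $(M,\mathfrak{m}_\Omega)$ is a left $R$-module $M$ with linear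 operators $\mathfrak{m}_\omega:M\to M$ ($\omega\in\Omega$) such that $P_\alpha(r)\mathfrak{m}_\beta(m)=\mathfrak{m}_\alpha(r\mathfrak{m}_\beta(m))+\mathfrak{m}_\beta(P_\alpha(r)m)+\lambda_\beta\mathfrak{m}_\alpha(rm)+\lambda_\alpha\mathfrak{m}_\beta(rm)$ for all $r\in R,m\in M,\alpha,\beta\in\Omega$. A homomorphism of left $(R,P_\Omega)$-modules is a left $R$-module homomorphism $\phi:(M,\mathfrak{m}_\Omega)\to(N,\mathfrak{n}_\Omega)$ with $\phi\circ\mathfrak{m}_\omega=\mathfrak{n}_\omega\circ\phi$ for all $\omega$. For a left $(R,P_\Omega)$-module $(M,\mathfrak{m}_\Omega)$, the set of module constants is $MC(M)=\{m\in M\mid \mathfrak{m}_\omega(rm)=P_\omega(r)m\text{ for all }r\in R,\omega\in\Omega\}$. A restricted free left $(R,P_\Omega)$-module on $X$ is a left $(R,P_\Omega)$-module $(F,\mathfrak{p}_\Omega)$ with a set map $j_X:X\to F$ such that for every left $(R,P_\Omega)$-module $(M,\mathfrak{m}_\Omega)$ and every set map $\varphi:X\to M$ with $\mathrm{im}(\varphi)\subseteq MC(M)$, there is a unique left $(R,P_\Omega)$-module homomorphism $\overline\varphi:(F,\mathfrak{p}_\Omega)\to(M,\mathfrak{m}_\Omega)$ with $\overline\varphi\circ j_X=\varphi$. *)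

theory Defs
  imports "HOL-Algebra.Module"
begin

text \<open>
  Everything is carrier-based, as in HOL-Algebra, so that the zero ring is not excluded.
  The distribution's locale \<^locale>\<open>algebra\<close> demands a commutative algebra and
  \<^locale>\<open>module\<close> a commutative base ring; the two locales below drop these
  requirements.  The scalar action of the base ring \<open>K\<close> on an algebra \<open>R\<close> is the
  \<^const>\<open>smult\<close> field of \<open>R\<close>.
\<close>

locale unital_algebra = module K R + A: ring R
  for K :: "('k, 'c) ring_scheme" (structure) and R :: "('k, 'r, 'a) module_scheme" (structure) +
  assumes smult_mult_left:
      "\<lbrakk>c \<in> carrier K; r \<in> carrier R; s \<in> carrier R\<rbrakk> \<Longrightarrow>
       (c \<odot>\<^bsub>R\<^esub> r) \<otimes>\<^bsub>R\<^esub> s = c \<odot>\<^bsub>R\<^esub> (r \<otimes>\<^bsub>R\<^esub> s)"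
    and smult_mult_right:
      "\<lbrakk>c \<in> carrier K; r \<in> carrier R; s \<in> carrier R\<rbrakk> \<Longrightarrow>
       r \<otimes>\<^bsub>R\<^esub> (c \<odot>\<^bsub>R\<^esub> s) = c \<odot>\<^bsub>R\<^esub> (r \<otimes>\<^bsub>R\<^esub> s)"

locale left_module = A: ring R + M: abelian_group M
  for R :: "('r, 'c) ring_scheme" (structure) and M :: "('r, 'm, 'b) module_scheme" (structure) +
  assumes smult_closed:
      "\<lbrakk>r \<in> carrier R; m \<in> carrier M\<rbrakk> \<Longrightarrow> r \<odot>\<^bsub>M\<^esub> m \<in> carrier M"
    and smult_l_distr:
      "\<lbrakk>r \<in> carrier R; s \<in> carrier R; m \<in> carrier M\<rbrakk> \<Longrightarrow>
       (r \<oplus>\<^bsub>R\<^esub> s) \<odot>\<^bsub>M\<^esub> m = r \<odot>\<^bsub>M\<^esub> m \<oplus>\<^bsub>M\<^esub> s \<odot>\<^bsub>M\<^esub> m"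
    and smult_r_distr:
      "\<lbrakk>r \<in> carrier R; m \<in> carrier M; n \<in> carrier M\<rbrakk> \<Longrightarrow>
       r \<odot>\<^bsub>M\<^esub> (m \<oplus>\<^bsub>M\<^esub> n) = r \<odot>\<^bsub>M\<^esub> m \<oplus>\<^bsub>M\<^esub> r \<odot>\<^bsub>M\<^esub> n"
    and smult_assoc:
      "\<lbrakk>r \<in> carrier R; s \<in> carrier R; m \<in> carrier M\<rbrakk> \<Longrightarrow>
       (r \<otimes>\<^bsub>R\<^esub> s) \<odot>\<^bsub>M\<^esub> m = r \<odot>\<^bsub>M\<^esub> (s \<odot>\<^bsub>M\<^esub> m)"
    and smult_one:
      "m \<in> carrier M \<Longrightarrow> \<one>\<^bsub>R\<^esub> \<odot>\<^bsub>M\<^esub> m = m"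

text \<open>
  A unital left module over a \<open>K\<close>-algebra \<open>R\<close> has exactly one compatible \<open>K\<close>-module
  structure, \<open>c m = (c 1\<^sub>R) m\<close>.
\<close>

definition restrict_scalars ::
    "('k, 'r, 'a) module_scheme \<Rightarrow> ('r, 'm, 'b) module_scheme \<Rightarrow> ('k, 'm) module" where
  "restrict_scalars R M =
     \<lparr>carrier = carrier M, monoid.mult = monoid.mult M, one = one M, ring.zero = ring.zero M, add = add M,
      smult = (\<lambda>c m. (c \<odot>\<^bsub>R\<^esub> \<one>\<^bsub>R\<^esub>) \<odot>\<^bsub>M\<^esub> m)\<rparr>"

definition linear_operator ::
    "('k, 'c) ring_scheme \<Rightarrow> ('k, 'v, 'd) module_scheme \<Rightarrow> ('v \<Rightarrow> 'v) \<Rightarrow> bool" where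
  "linear_operator K V f \<longleftrightarrow>
     f \<in> carrier V \<rightarrow> carrier V \<and>
     (\<forall>u\<in>carrier V. \<forall>v\<in>carrier V. f (u \<oplus>\<^bsub>V\<^esub> v) = f u \<oplus>\<^bsub>V\<^esub> f v) \<and>
     (\<forall>c\<in>carrier K. \<forall>v\<in>carrier V. f (c \<odot>\<^bsub>V\<^esub> v) = c \<odot>\<^bsub>V\<^esub> f v)"

text \<open>The weight family \<open>w\<close> plays both roles in the pair weight.\<close>

locale multiple_rota_baxter_algebra = unital_algebra K R
  for K :: "('k, 'c) ring_scheme" (structure) and R :: "('k, 'r, 'a) module_scheme" (structure) +
  fixes \<Omega> :: "'o set" and w :: "'o \<Rightarrow> 'k" and P :: "'o \<Rightarrow> 'r \<Rightarrow> 'r"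
  assumes index_nonempty: "\<Omega> \<noteq> {}"
    and weight_closed: "w \<in> \<Omega> \<rightarrow> carrier K"
    and P_linear: "\<alpha> \<in> \<Omega> \<Longrightarrow> linear_operator K R (P \<alpha>)"
    and rota_baxter:
      "\<lbrakk>\<alpha> \<in> \<Omega>; \<beta> \<in> \<Omega>; r \<in> carrier R; s \<in> carrier R\<rbrakk> \<Longrightarrow>
       P \<alpha> r \<otimes>\<^bsub>R\<^esub> P \<beta> s =
         P \<alpha> (r \<otimes>\<^bsub>R\<^esub> P \<beta> s) \<oplus>\<^bsub>R\<^esub> P \<beta> (P \<alpha> r \<otimes>\<^bsub>R\<^esub> s) \<oplus>\<^bsub>R\<^esub>
         w \<beta> \<odot>\<^bsub>R\<^esub> P \<alpha> (r \<otimes>\<^bsub>R\<^esub> s) \<oplus>\<^bsub>R\<^esub> w \<alpha> \<odot>\<^bsub>R\<^esub> P \<beta> (r \<otimes>\<^bsub>R\<^esub> s)"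

locale left_rota_baxter_module =
    multiple_rota_baxter_algebra K R \<Omega> w P + M: left_module R M
  for K :: "('k, 'c) ring_scheme" (structure) and R :: "('k, 'r, 'a) module_scheme" (structure)
    and \<Omega> :: "'o set" and w :: "'o \<Rightarrow> 'k" and P :: "'o \<Rightarrow> 'r \<Rightarrow> 'r"
    and M :: "('r, 'm, 'b) module_scheme" (structure) +
  fixes p :: "'o \<Rightarrow> 'm \<Rightarrow> 'm"
  assumes p_linear: "\<alpha> \<in> \<Omega> \<Longrightarrow> linear_operator K (restrict_scalars R M) (p \<alpha>)"
    and rota_baxter_module:
      "\<lbrakk>\<alpha> \<in> \<Omega>; \<beta> \<in> \<Omega>; r \<in> carrier R; m \<in> carrier M\<rbrakk> \<Longrightarrow>
       P \<alpha> r \<odot>\<^bsub>M\<^esub> p \<beta> m =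
         p \<alpha> (r \<odot>\<^bsub>M\<^esub> p \<beta> m) \<oplus>\<^bsub>M\<^esub> p \<beta> (P \<alpha> r \<odot>\<^bsub>M\<^esub> m) \<oplus>\<^bsub>M\<^esub>
         w \<beta> \<odot>\<^bsub>restrict_scalars R M\<^esub> p \<alpha> (r \<odot>\<^bsub>M\<^esub> m) \<oplus>\<^bsub>M\<^esub>
         w \<alpha> \<odot>\<^bsub>restrict_scalars R M\<^esub> p \<beta> (r \<odot>\<^bsub>M\<^esub> m)"

definition rota_baxter_module_hom ::
    "('r, 'c) ring_scheme \<Rightarrow> 'o set \<Rightarrow>
     ('r, 'm, 'a) module_scheme \<Rightarrow> ('o \<Rightarrow> 'm \<Rightarrow> 'm) \<Rightarrow>
     ('r, 'n, 'b) module_scheme \<Rightarrow> ('o \<Rightarrow> 'n \<Rightarrow> 'n) \<Rightarrow> ('m \<Rightarrow> 'n) set" where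
  "rota_baxter_module_hom R \<Omega> M p N q =
     {h \<in> carrier M \<rightarrow> carrier N.
        (\<forall>m\<in>carrier M. \<forall>n\<in>carrier M. h (m \<oplus>\<^bsub>M\<^esub> n) = h m \<oplus>\<^bsub>N\<^esub> h n) \<and>
        (\<forall>r\<in>carrier R. \<forall>m\<in>carrier M. h (r \<odot>\<^bsub>M\<^esub> m) = r \<odot>\<^bsub>N\<^esub> h m) \<and>
        (\<forall>\<omega>\<in>\<Omega>. \<forall>m\<in>carrier M. h (p \<omega> m) = q \<omega> (h m))}"

definition module_constants ::
    "('r, 'c) ring_scheme \<Rightarrow> 'o set \<Rightarrow> ('o \<Rightarrow> 'r \<Rightarrow> 'r) \<Rightarrow>
     ('r, 'm, 'a) module_scheme \<Rightarrow> ('o \<Rightarrow> 'm \<Rightarrow> 'm) \<Rightarrow> 'm set" where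
  "module_constants R \<Omega> P M p =
     {m \<in> carrier M. \<forall>r\<in>carrier R. \<forall>\<omega>\<in>\<Omega>. p \<omega> (r \<odot>\<^bsub>M\<^esub> m) = P \<omega> r \<odot>\<^bsub>M\<^esub> m}"

text \<open>
  HOL cannot quantify over types inside a formula, so the type \<open>'m\<close> of the test modules is a
  parameter; a theorem in which \<open>'m\<close> is a type variable covers test modules of every type.
  Homomorphisms are taken in \<^const>\<open>extensional\<close> form because a HOL function is not
  determined by its values on the carrier.
\<close>

definition restricted_free_module ::
    "'m itself \<Rightarrow> ('k, 'c) ring_scheme \<Rightarrow> ('k, 'r, 'a) module_scheme \<Rightarrow>
     'o set \<Rightarrow> ('o \<Rightarrow> 'k) \<Rightarrow> ('o \<Rightarrow> 'r \<Rightarrow> 'r) \<Rightarrow> 'x set \<Rightarrow>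
     ('r, 'f, 'b) module_scheme \<Rightarrow> ('o \<Rightarrow> 'f \<Rightarrow> 'f) \<Rightarrow> ('x \<Rightarrow> 'f) \<Rightarrow> bool" where
  "restricted_free_module (t :: 'm itself) K R \<Omega> w P X F p j \<longleftrightarrow>
     left_rota_baxter_module K R \<Omega> w P F p \<and>
     j \<in> X \<rightarrow> carrier F \<and>
     (\<forall>(M :: ('r, 'm) module) q \<phi>.
        left_rota_baxter_module K R \<Omega> w P M q \<longrightarrow>
        \<phi> \<in> X \<rightarrow> carrier M \<longrightarrow>
        \<phi> ` X \<subseteq> module_constants R \<Omega> P M q \<longrightarrow>
        (\<exists>!h. h \<in> rota_baxter_module_hom R \<Omega> F p M q \<and>
              h \<in> extensional (carrier F) \<and>
              (\<forall>x\<in>X. h (j x) = \<phi> x)))"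

text \<open>
  The formal sum \<open>\<Sum>\<^sub>x r\<^sub>x x\<close> is encoded by its coefficient function \<open>x \<mapsto> r\<^sub>x\<close>, made
  extensional on \<open>X\<close>.  The \<^const>\<open>monoid.mult\<close> and \<^const>\<open>one\<close> fields of the record carry no
  meaning for a module.
\<close>

definition free_left_module ::
    "('r, 'c) ring_scheme \<Rightarrow> 'x set \<Rightarrow> ('r, 'x \<Rightarrow> 'r) module" where
  "free_left_module R X =
     \<lparr>carrier = {f \<in> X \<rightarrow>\<^sub>E carrier R. finite {x \<in> X. f x \<noteq> \<zero>\<^bsub>R\<^esub>}},
      monoid.mult = undefined, one = undefined,
      ring.zero = (\<lambda>x\<in>X. \<zero>\<^bsub>R\<^esub>),
      add = (\<lambda>f g. \<lambda>x\<in>X. f x \<oplus>\<^bsub>R\<^esub> g x),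
      smult = (\<lambda>r f. \<lambda>x\<in>X. r \<otimes>\<^bsub>R\<^esub> f x)\<rparr>"

definition free_left_module_embedding ::
    "('r, 'c) ring_scheme \<Rightarrow> 'x set \<Rightarrow> 'x \<Rightarrow> 'x \<Rightarrow> 'r" where
  "free_left_module_embedding R X x =
     (\<lambda>y\<in>X. if y = x then \<one>\<^bsub>R\<^esub> else \<zero>\<^bsub>R\<^esub>)"

definition coefficientwise :: "'x set \<Rightarrow> ('o \<Rightarrow> 'r \<Rightarrow> 'r) \<Rightarrow> 'o \<Rightarrow> ('x \<Rightarrow> 'r) \<Rightarrow> 'x \<Rightarrow> 'r" where
  "coefficientwise X P \<omega> f = (\<lambda>x\<in>X. P \<omega> (f x))"

end

theory Submission
  imports Defs
begin

text \<open>
  The operators on the free module \<open>F\<close> are defined one coefficient at a time, and so are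
  addition and scalar multiplication.  Hence each axiom of a Rota-Baxter module for \<open>F\<close> is, at a
  fixed coordinate, the corresponding axiom of the Rota-Baxter algebra \<open>R\<close>; the only
  translation needed is that \<open>(c 1) r = c r\<close> for a scalar \<open>c\<close> of the base ring.

  For the universal property, let \<open>j x\<close> be the basis vector at \<open>x\<close>.  A homomorphism out of \<open>F\<close> with
  \<open>j x \<mapsto> \<phi>(x)\<close> is forced to send \<open>\<Sum> r\<^sub>x j x\<close> to \<open>\<Sum> r\<^sub>x \<phi>(x)\<close>, and this formula is additive.  All remaining assertions
  (linearity over \<open>R\<close>, compatibility with the operators, uniqueness) are equalities between two
  additive maps on \<open>F\<close>.  Since the monomials \<open>r j x\<close> generate \<open>F\<close> as an additive group, it
  suffices to compare such maps on monomials (\<open>additive_maps_eqI\<close>).  For the operators the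
  comparison reads \<open>P\<^sub>\<omega>(r) \<phi>(x) = q\<^sub>\<omega>(r \<phi>(x))\<close>, which is exactly the condition that \<open>\<phi>(x)\<close> is a
  module constant.
\<close>

section \<open>The free module\<close>

lemma (in ring) free_left_module_abelian_group:
  "abelian_group (free_left_module R X)"
proof (rule abelian_groupI)
  fix f g assume fg: "f \<in> carrier (free_left_module R X)" "g \<in> carrier (free_left_module R X)"
  have "finite ({x \<in> X. f x \<noteq> \<zero>} \<union> {x \<in> X. g x \<noteq> \<zero>})"
    using fg by (simp add: free_left_module_def)
  then have "finite {x \<in> X. f x \<oplus> g x \<noteq> \<zero>}"
    by (rule rev_finite_subset) auto
  moreover have "{x \<in> X. (\<lambda>x\<in>X. f x \<oplus> g x) x \<noteq> \<zero>} = {x \<in> X. f x \<oplus> g x \<noteq> \<zero>}"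
    by auto
  ultimately show "f \<oplus>\<^bsub>free_left_module R X\<^esub> g \<in> carrier (free_left_module R X)"
    using fg by (auto simp: free_left_module_def PiE_iff)
next
  fix f assume f: "f \<in> carrier (free_left_module R X)"
  have "{x \<in> X. (\<lambda>x\<in>X. \<ominus> f x) x \<noteq> \<zero>} = {x \<in> X. f x \<noteq> \<zero>}"
    using f by (auto simp: free_left_module_def PiE_iff)
  then have "(\<lambda>x\<in>X. \<ominus> f x) \<in> carrier (free_left_module R X)"
    using f by (auto simp: free_left_module_def PiE_iff)
  moreover have "(\<lambda>x\<in>X. \<ominus> f x) \<oplus>\<^bsub>free_left_module R X\<^esub> f = \<zero>\<^bsub>free_left_module R X\<^esub>"
    using f by (auto simp: free_left_module_def PiE_iff l_neg)
  ultimately show "\<exists>g\<in>carrier (free_left_module R X).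
      g \<oplus>\<^bsub>free_left_module R X\<^esub> f = \<zero>\<^bsub>free_left_module R X\<^esub>" by blast
next
  show "\<zero>\<^bsub>free_left_module R X\<^esub> \<in> carrier (free_left_module R X)"
    by (simp add: free_left_module_def cong: conj_cong)
next
  fix f assume "f \<in> carrier (free_left_module R X)"
  then show "\<zero>\<^bsub>free_left_module R X\<^esub> \<oplus>\<^bsub>free_left_module R X\<^esub> f = f"
    by (auto simp: free_left_module_def PiE_iff fun_eq_iff extensional_def restrict_def)
next
  fix f g h
  assume "f \<in> carrier (free_left_module R X)" "g \<in> carrier (free_left_module R X)"
    "h \<in> carrier (free_left_module R X)"
  then show "f \<oplus>\<^bsub>free_left_module R X\<^esub> g \<oplus>\<^bsub>free_left_module R X\<^esub> h =
      f \<oplus>\<^bsub>free_left_module R X\<^esub> (g \<oplus>\<^bsub>free_left_module R X\<^esub> h)"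
    by (auto simp: free_left_module_def PiE_iff fun_eq_iff a_assoc restrict_def)
next
  fix f g
  assume "f \<in> carrier (free_left_module R X)" "g \<in> carrier (free_left_module R X)"
  then show "f \<oplus>\<^bsub>free_left_module R X\<^esub> g = g \<oplus>\<^bsub>free_left_module R X\<^esub> f"
    by (auto simp: free_left_module_def PiE_iff fun_eq_iff a_comm restrict_def)
qed

lemma (in ring) free_left_module_smult_closed:
  assumes "r \<in> carrier R" "f \<in> carrier (free_left_module R X)"
  shows "r \<odot>\<^bsub>free_left_module R X\<^esub> f \<in> carrier (free_left_module R X)"
proof -
  have "finite {x \<in> X. f x \<noteq> \<zero>}"
    using assms by (simp add: free_left_module_def)
  then have "finite {x \<in> X. r \<otimes> f x \<noteq> \<zero>}"
    by (rule rev_finite_subset) (use assms in auto)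
  moreover have "{x \<in> X. (\<lambda>x\<in>X. r \<otimes> f x) x \<noteq> \<zero>} = {x \<in> X. r \<otimes> f x \<noteq> \<zero>}"
    by auto
  ultimately show ?thesis
    using assms by (auto simp: free_left_module_def PiE_iff)
qed

lemma (in ring) free_left_module_left_module:
  "left_module R (free_left_module R X)"
proof (intro left_module.intro left_module_axioms.intro)
  show "ring R" by (rule ring_axioms)
  show "abelian_group (free_left_module R X)" by (rule free_left_module_abelian_group)
qed (simp add: free_left_module_smult_closed,
     auto simp: free_left_module_def PiE_iff fun_eq_iff l_distr r_distr m_assoc restrict_def
       extensional_def)

lemma (in ring) free_left_module_embedding_closed:
  "free_left_module_embedding R X x \<in> carrier (free_left_module R X)"
proof -
  have "finite {y \<in> X. free_left_module_embedding R X x y \<noteq> \<zero>}"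
    by (rule finite_subset[of _ "{x}"]) (auto simp: free_left_module_embedding_def)
  then show ?thesis
    by (auto simp: free_left_module_def free_left_module_embedding_def)
qed

lemma (in ring) free_left_module_monomial:
  assumes "r \<in> carrier R"
  shows "r \<odot>\<^bsub>free_left_module R X\<^esub> free_left_module_embedding R X x =
    (\<lambda>y\<in>X. if y = x then r else \<zero>)"
  using assms by (auto simp: free_left_module_def free_left_module_embedding_def)

text \<open>
  A vector with support in \<open>insert x A\<close> is a vector with support in \<open>A\<close> plus a monomial at \<open>x\<close>;
  since supports are finite, the vectors are reached from zero by adding monomials.
\<close>

lemma (in ring) free_left_module_induct [consumes 1, case_names zero add]:
  assumes "f \<in> carrier (free_left_module R X)"
    and zero: "Q \<zero>\<^bsub>free_left_module R X\<^esub>"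
    and add: "\<And>f r x. \<lbrakk>f \<in> carrier (free_left_module R X); r \<in> carrier R; x \<in> X; Q f\<rbrakk> \<Longrightarrow>
      Q (f \<oplus>\<^bsub>free_left_module R X\<^esub>
         r \<odot>\<^bsub>free_left_module R X\<^esub> free_left_module_embedding R X x)"
  shows "Q f"
proof -
  have finite_support: "Q f" if "finite A" "A \<subseteq> X" "f \<in> carrier (free_left_module R X)"
    "\<And>x. x \<in> X - A \<Longrightarrow> f x = \<zero>" for A f
    using that
  proof (induction A arbitrary: f rule: finite_induct)
    case empty
    then have "f = \<zero>\<^bsub>free_left_module R X\<^esub>"
      by (auto simp: free_left_module_def PiE_iff fun_eq_iff extensional_def)
    then show ?case using zero by simp
  next
    case (insert x A)
    let ?g = "\<lambda>y\<in>X. if y = x then \<zero> else f y"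
    have fx: "f x \<in> carrier R"
      using insert.prems by (auto simp: free_left_module_def PiE_iff)
    have "finite {y \<in> X. ?g y \<noteq> \<zero>}"
      by (rule finite_subset[OF _ insert.hyps(1)]) (use insert.prems in auto)
    then have g: "?g \<in> carrier (free_left_module R X)"
      using insert.prems by (auto simp: free_left_module_def PiE_iff)
    have "Q ?g"
      by (rule insert.IH[OF _ g]) (use insert.prems in auto)
    then have "Q (?g \<oplus>\<^bsub>free_left_module R X\<^esub>
        f x \<odot>\<^bsub>free_left_module R X\<^esub> free_left_module_embedding R X x)"
      using add g fx insert.prems by blast
    also have "?g \<oplus>\<^bsub>free_left_module R X\<^esub>
        f x \<odot>\<^bsub>free_left_module R X\<^esub> free_left_module_embedding R X x = f"
      using insert.prems fx
      by (auto simp: free_left_module_monomial)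
        (auto simp: free_left_module_def PiE_iff fun_eq_iff extensional_def restrict_def)
    finally show ?case .
  qed
  show ?thesis
  proof (rule finite_support)
    show "finite {x \<in> X. f x \<noteq> \<zero>}"
      using assms(1) by (simp add: free_left_module_def)
  qed (use assms(1) in auto)
qed

text \<open>
  Only additivity is required of the two maps, so the lemma applies equally to maps composed with
  scalar multiplications, which need not be \<open>R\<close>-linear when \<open>R\<close> is noncommutative, and with the
  operators, which are not \<open>R\<close>-linear in general.
\<close>

lemma (in ring) additive_maps_eqI:
  fixes N :: "('n, 'd) ring_scheme"
  assumes "abelian_group N"
    and closed: "g \<in> carrier (free_left_module R X) \<rightarrow> carrier N"
      "h \<in> carrier (free_left_module R X) \<rightarrow> carrier N"
    and g_add: "\<And>u v. \<lbrakk>u \<in> carrier (free_left_module R X); v \<in> carrier (free_left_module R X)\<rbrakk>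
      \<Longrightarrow> g (u \<oplus>\<^bsub>free_left_module R X\<^esub> v) = g u \<oplus>\<^bsub>N\<^esub> g v"
    and h_add: "\<And>u v. \<lbrakk>u \<in> carrier (free_left_module R X); v \<in> carrier (free_left_module R X)\<rbrakk>
      \<Longrightarrow> h (u \<oplus>\<^bsub>free_left_module R X\<^esub> v) = h u \<oplus>\<^bsub>N\<^esub> h v"
    and monomial: "\<And>r x. \<lbrakk>r \<in> carrier R; x \<in> X\<rbrakk> \<Longrightarrow>
      g (r \<odot>\<^bsub>free_left_module R X\<^esub> free_left_module_embedding R X x) =
      h (r \<odot>\<^bsub>free_left_module R X\<^esub> free_left_module_embedding R X x)"
    and "f \<in> carrier (free_left_module R X)"
  shows "g f = h f"
proof -
  interpret F: abelian_group "free_left_module R X" by (rule free_left_module_abelian_group)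
  interpret N: abelian_group N by fact
  have additive_zero: "k \<zero>\<^bsub>free_left_module R X\<^esub> = \<zero>\<^bsub>N\<^esub>"
    if "k \<in> carrier (free_left_module R X) \<rightarrow> carrier N"
      "\<And>u v. \<lbrakk>u \<in> carrier (free_left_module R X); v \<in> carrier (free_left_module R X)\<rbrakk>
        \<Longrightarrow> k (u \<oplus>\<^bsub>free_left_module R X\<^esub> v) = k u \<oplus>\<^bsub>N\<^esub> k v" for k
  proof -
    have "k \<zero>\<^bsub>free_left_module R X\<^esub> \<in> carrier N"
      using that(1) F.zero_closed by (rule funcset_mem)
    then show ?thesis
      using that(2)[OF F.zero_closed F.zero_closed] by simp
  qed
  show ?thesis
    using \<open>f \<in> _\<close>
  proof (induction rule: free_left_module_induct)
    case zero
    have "g \<zero>\<^bsub>free_left_module R X\<^esub> = \<zero>\<^bsub>N\<^esub>"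
      using closed(1) by (rule additive_zero) (rule g_add)
    moreover have "h \<zero>\<^bsub>free_left_module R X\<^esub> = \<zero>\<^bsub>N\<^esub>"
      using closed(2) by (rule additive_zero) (rule h_add)
    ultimately show ?case by simp
  next
    case (add f r x)
    then show ?case
      by (simp add: g_add h_add monomial free_left_module_smult_closed
          free_left_module_embedding_closed)
  qed
qed

section \<open>Coefficientwise operators\<close>

lemma (in multiple_rota_baxter_algebra) P_closed:
  "\<lbrakk>\<alpha> \<in> \<Omega>; r \<in> carrier R\<rbrakk> \<Longrightarrow> P \<alpha> r \<in> carrier R"
  using P_linear[of \<alpha>] by (auto simp: linear_operator_def)

lemma (in multiple_rota_baxter_algebra) P_add:
  "\<lbrakk>\<alpha> \<in> \<Omega>; r \<in> carrier R; s \<in> carrier R\<rbrakk> \<Longrightarrow> P \<alpha> (r \<oplus>\<^bsub>R\<^esub> s) = P \<alpha> r \<oplus>\<^bsub>R\<^esub> P \<alpha> s"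
  using P_linear[of \<alpha>] by (auto simp: linear_operator_def)

lemma (in multiple_rota_baxter_algebra) P_smult:
  "\<lbrakk>\<alpha> \<in> \<Omega>; c \<in> carrier K; r \<in> carrier R\<rbrakk> \<Longrightarrow> P \<alpha> (c \<odot>\<^bsub>R\<^esub> r) = c \<odot>\<^bsub>R\<^esub> P \<alpha> r"
  using P_linear[of \<alpha>] by (auto simp: linear_operator_def)

lemma (in multiple_rota_baxter_algebra) P_zero:
  "\<alpha> \<in> \<Omega> \<Longrightarrow> P \<alpha> \<zero>\<^bsub>R\<^esub> = \<zero>\<^bsub>R\<^esub>"
  using P_add[of \<alpha> "\<zero>\<^bsub>R\<^esub>" "\<zero>\<^bsub>R\<^esub>"] P_closed[of \<alpha> "\<zero>\<^bsub>R\<^esub>"]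
  by simp

text \<open>
  On the free module the scalars of \<open>K\<close> act through \<open>c \<mapsto> c 1\<close>; associativity of the \<open>K\<close>-action
  with the multiplication of \<open>R\<close> turns this into the original action on each coefficient.
\<close>

lemma (in unital_algebra) smult_one_mult:
  "\<lbrakk>c \<in> carrier K; r \<in> carrier R\<rbrakk> \<Longrightarrow> (c \<odot>\<^bsub>R\<^esub> \<one>\<^bsub>R\<^esub>) \<otimes>\<^bsub>R\<^esub> r = c \<odot>\<^bsub>R\<^esub> r"
  by (simp add: smult_mult_left)

lemma (in multiple_rota_baxter_algebra) coefficientwise_closed:
  assumes "\<alpha> \<in> \<Omega>" "f \<in> carrier (free_left_module R X)"
  shows "coefficientwise X P \<alpha> f \<in> carrier (free_left_module R X)"
proof -
  have "finite {x \<in> X. f x \<noteq> \<zero>\<^bsub>R\<^esub>}"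
    using assms by (simp add: free_left_module_def)
  then have "finite {x \<in> X. coefficientwise X P \<alpha> f x \<noteq> \<zero>\<^bsub>R\<^esub>}"
    by (rule rev_finite_subset) (use assms P_zero in \<open>auto simp: coefficientwise_def\<close>)
  then show ?thesis
    using assms by (auto simp: free_left_module_def coefficientwise_def PiE_iff P_closed)
qed

lemma (in multiple_rota_baxter_algebra) coefficientwise_add:
  assumes "\<alpha> \<in> \<Omega>" "f \<in> carrier (free_left_module R X)" "g \<in> carrier (free_left_module R X)"
  shows "coefficientwise X P \<alpha> (f \<oplus>\<^bsub>free_left_module R X\<^esub> g) =
    coefficientwise X P \<alpha> f \<oplus>\<^bsub>free_left_module R X\<^esub> coefficientwise X P \<alpha> g"
  using assms by (auto simp: free_left_module_def coefficientwise_def PiE_iff P_add)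

lemma (in multiple_rota_baxter_algebra) coefficientwise_monomial:
  assumes "\<alpha> \<in> \<Omega>" "r \<in> carrier R"
  shows "coefficientwise X P \<alpha> (r \<odot>\<^bsub>free_left_module R X\<^esub> free_left_module_embedding R X x) =
    P \<alpha> r \<odot>\<^bsub>free_left_module R X\<^esub> free_left_module_embedding R X x"
  using assms
  by (auto simp: A.free_left_module_monomial coefficientwise_def P_closed P_zero)

lemma (in multiple_rota_baxter_algebra) free_left_rota_baxter_module:
  "left_rota_baxter_module K R \<Omega> w P (free_left_module R X) (coefficientwise X P)"
proof (intro left_rota_baxter_module.intro left_rota_baxter_module_axioms.intro)
  show "multiple_rota_baxter_algebra K R \<Omega> w P" by (rule multiple_rota_baxter_algebra_axioms)
  show "left_module R (free_left_module R X)" by (rule A.free_left_module_left_module)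
next
  fix \<alpha> assume "\<alpha> \<in> \<Omega>"
  moreover have "coefficientwise X P \<alpha> (smult (restrict_scalars R (free_left_module R X)) c f) =
      smult (restrict_scalars R (free_left_module R X)) c (coefficientwise X P \<alpha> f)"
    if "c \<in> carrier K" "f \<in> carrier (free_left_module R X)" for c f
    using that \<open>\<alpha> \<in> \<Omega>\<close>
    by (auto simp: restrict_scalars_def free_left_module_def coefficientwise_def PiE_iff
        smult_one_mult P_smult P_closed)
  ultimately show "linear_operator K (restrict_scalars R (free_left_module R X))
      (coefficientwise X P \<alpha>)"
    by (simp add: linear_operator_def restrict_scalars_def coefficientwise_closed
        coefficientwise_add)
next
  fix \<alpha> \<beta> r f
  assume \<alpha>\<beta>: "\<alpha> \<in> \<Omega>" "\<beta> \<in> \<Omega>" and r: "r \<in> carrier R"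
    and f: "f \<in> carrier (free_left_module R X)"
  have "w \<alpha> \<in> carrier K" "w \<beta> \<in> carrier K"
    using weight_closed \<alpha>\<beta> by auto
  then show "P \<alpha> r \<odot>\<^bsub>free_left_module R X\<^esub> coefficientwise X P \<beta> f =
      coefficientwise X P \<alpha> (r \<odot>\<^bsub>free_left_module R X\<^esub> coefficientwise X P \<beta> f)
      \<oplus>\<^bsub>free_left_module R X\<^esub>
      coefficientwise X P \<beta> (P \<alpha> r \<odot>\<^bsub>free_left_module R X\<^esub> f) \<oplus>\<^bsub>free_left_module R X\<^esub>
      w \<beta> \<odot>\<^bsub>restrict_scalars R (free_left_module R X)\<^esub>
        coefficientwise X P \<alpha> (r \<odot>\<^bsub>free_left_module R X\<^esub> f) \<oplus>\<^bsub>free_left_module R X\<^esub>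
      w \<alpha> \<odot>\<^bsub>restrict_scalars R (free_left_module R X)\<^esub>
        coefficientwise X P \<beta> (r \<odot>\<^bsub>free_left_module R X\<^esub> f)"
    using \<alpha>\<beta> r f
    by (auto simp: restrict_scalars_def free_left_module_def coefficientwise_def PiE_iff
        smult_one_mult P_closed rota_baxter fun_eq_iff restrict_def)
qed

section \<open>Linear extension\<close>

lemma (in left_module) smult_zero_left:
  assumes "m \<in> carrier M"
  shows "\<zero>\<^bsub>R\<^esub> \<odot>\<^bsub>M\<^esub> m = \<zero>\<^bsub>M\<^esub>"
  using assms smult_l_distr[of "\<zero>\<^bsub>R\<^esub>" "\<zero>\<^bsub>R\<^esub>" m] smult_closed[of "\<zero>\<^bsub>R\<^esub>" m]
  by (metis A.zero_closed A.r_zero M.add.l_cancel_one)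

definition linear_extension ::
    "('r, 'c) ring_scheme \<Rightarrow> 'x set \<Rightarrow> ('r, 'm, 'b) module_scheme \<Rightarrow> ('x \<Rightarrow> 'm) \<Rightarrow>
     ('x \<Rightarrow> 'r) \<Rightarrow> 'm" where
  "linear_extension R X M \<phi> =
     (\<lambda>f\<in>carrier (free_left_module R X).
        finsum M (\<lambda>x. f x \<odot>\<^bsub>M\<^esub> \<phi> x) {x \<in> X. f x \<noteq> \<zero>\<^bsub>R\<^esub>})"

text \<open>
  The support of a sum is not determined by the supports of the summands.  Summing over a common
  finite superset of all supports involved makes the formula visibly additive.
\<close>

lemma (in left_module) linear_extension_eq_finsum:
  assumes "\<phi> \<in> X \<rightarrow> carrier M" "f \<in> carrier (free_left_module R X)"
    and "finite A" "A \<subseteq> X" "{x \<in> X. f x \<noteq> \<zero>\<^bsub>R\<^esub>} \<subseteq> A"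
  shows "linear_extension R X M \<phi> f = finsum M (\<lambda>x. f x \<odot>\<^bsub>M\<^esub> \<phi> x) A"
proof -
  have "finsum M (\<lambda>x. f x \<odot>\<^bsub>M\<^esub> \<phi> x) {x \<in> X. f x \<noteq> \<zero>\<^bsub>R\<^esub>} = finsum M (\<lambda>x. f x \<odot>\<^bsub>M\<^esub> \<phi> x) A"
  proof (rule M.add.finprod_mono_neutral_cong_left)
    show "(\<lambda>x. f x \<odot>\<^bsub>M\<^esub> \<phi> x) \<in> A \<rightarrow> carrier M"
      using assms by (auto simp: free_left_module_def PiE_iff intro!: smult_closed)
    fix x assume "x \<in> A - {x \<in> X. f x \<noteq> \<zero>\<^bsub>R\<^esub>}"
    then show "f x \<odot>\<^bsub>M\<^esub> \<phi> x = \<zero>\<^bsub>M\<^esub>"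
      using assms by (auto simp: smult_zero_left Pi_iff subset_iff)
  qed (use assms in auto)
  then show ?thesis using assms by (simp add: linear_extension_def)
qed

lemma (in left_module) linear_extension_closed:
  assumes "\<phi> \<in> X \<rightarrow> carrier M" "f \<in> carrier (free_left_module R X)"
  shows "linear_extension R X M \<phi> f \<in> carrier M"
  using assms
  by (auto simp: linear_extension_def free_left_module_def PiE_iff Pi_iff
      intro!: M.finsum_closed smult_closed)

lemma (in left_module) linear_extension_add:
  assumes \<phi>: "\<phi> \<in> X \<rightarrow> carrier M"
    and f: "f \<in> carrier (free_left_module R X)" and g: "g \<in> carrier (free_left_module R X)"
  shows "linear_extension R X M \<phi> (f \<oplus>\<^bsub>free_left_module R X\<^esub> g) =
    linear_extension R X M \<phi> f \<oplus>\<^bsub>M\<^esub> linear_extension R X M \<phi> g"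
proof -
  interpret F: abelian_group "free_left_module R X" by (rule A.free_left_module_abelian_group)
  let ?A = "{x \<in> X. f x \<noteq> \<zero>\<^bsub>R\<^esub>} \<union> {x \<in> X. g x \<noteq> \<zero>\<^bsub>R\<^esub>}"
  have A: "finite ?A" "?A \<subseteq> X"
    using f g by (auto simp: free_left_module_def)
  have sum_apply: "(f \<oplus>\<^bsub>free_left_module R X\<^esub> g) x = f x \<oplus>\<^bsub>R\<^esub> g x" if "x \<in> X" for x
    using that by (simp add: free_left_module_def)
  have coeff: "f x \<in> carrier R" "g x \<in> carrier R" "\<phi> x \<in> carrier M" if "x \<in> X" for x
    using that f g \<phi> by (auto simp: free_left_module_def PiE_iff)
  have "linear_extension R X M \<phi> (f \<oplus>\<^bsub>free_left_module R X\<^esub> g) =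
      finsum M (\<lambda>x. (f \<oplus>\<^bsub>free_left_module R X\<^esub> g) x \<odot>\<^bsub>M\<^esub> \<phi> x) ?A"
    by (rule linear_extension_eq_finsum[OF \<phi> F.a_closed[OF f g] A])
      (auto simp: sum_apply)
  also have "\<dots> = finsum M (\<lambda>x. f x \<odot>\<^bsub>M\<^esub> \<phi> x \<oplus>\<^bsub>M\<^esub> g x \<odot>\<^bsub>M\<^esub> \<phi> x) ?A"
    by (rule M.finsum_cong') (auto simp: sum_apply coeff smult_l_distr smult_closed)
  also have "\<dots> = finsum M (\<lambda>x. f x \<odot>\<^bsub>M\<^esub> \<phi> x) ?A \<oplus>\<^bsub>M\<^esub> finsum M (\<lambda>x. g x \<odot>\<^bsub>M\<^esub> \<phi> x) ?A"
    by (rule M.finsum_addf) (auto simp: coeff smult_closed)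
  also have "\<dots> = linear_extension R X M \<phi> f \<oplus>\<^bsub>M\<^esub> linear_extension R X M \<phi> g"
    using linear_extension_eq_finsum[OF \<phi> f A] linear_extension_eq_finsum[OF \<phi> g A] by auto
  finally show ?thesis .
qed

lemma (in left_module) linear_extension_monomial:
  assumes \<phi>: "\<phi> \<in> X \<rightarrow> carrier M" and r: "r \<in> carrier R" and x: "x \<in> X"
  shows "linear_extension R X M \<phi>
      (r \<odot>\<^bsub>free_left_module R X\<^esub> free_left_module_embedding R X x) = r \<odot>\<^bsub>M\<^esub> \<phi> x"
proof -
  let ?u = "r \<odot>\<^bsub>free_left_module R X\<^esub> free_left_module_embedding R X x"
  have u: "?u = (\<lambda>y\<in>X. if y = x then r else \<zero>\<^bsub>R\<^esub>)"
    by (rule A.free_left_module_monomial[OF r])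
  have "linear_extension R X M \<phi> ?u = finsum M (\<lambda>y. ?u y \<odot>\<^bsub>M\<^esub> \<phi> y) {x}"
  proof (rule linear_extension_eq_finsum[OF \<phi>])
    show "?u \<in> carrier (free_left_module R X)"
      using r by (intro A.free_left_module_smult_closed A.free_left_module_embedding_closed)
  qed (use x in \<open>auto simp: u\<close>)
  also have "\<dots> = r \<odot>\<^bsub>M\<^esub> \<phi> x"
    using \<phi> r x by (auto simp: u Pi_iff smult_closed)
  finally show ?thesis .
qed

lemma (in left_module) linear_extension_smult:
  assumes \<phi>: "\<phi> \<in> X \<rightarrow> carrier M" and r: "r \<in> carrier R"
    and f: "f \<in> carrier (free_left_module R X)"
  shows "linear_extension R X M \<phi> (r \<odot>\<^bsub>free_left_module R X\<^esub> f) =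
    r \<odot>\<^bsub>M\<^esub> linear_extension R X M \<phi> f"
proof -
  interpret F: left_module R "free_left_module R X" by (rule A.free_left_module_left_module)
  show ?thesis
  proof (rule A.additive_maps_eqI[OF M.abelian_group_axioms _ _ _ _ _ f])
    fix s x assume "s \<in> carrier R" "x \<in> X"
    then show "linear_extension R X M \<phi> (r \<odot>\<^bsub>free_left_module R X\<^esub>
          (s \<odot>\<^bsub>free_left_module R X\<^esub> free_left_module_embedding R X x)) =
        r \<odot>\<^bsub>M\<^esub> linear_extension R X M \<phi>
          (s \<odot>\<^bsub>free_left_module R X\<^esub> free_left_module_embedding R X x)"
      using \<phi> r
      by (auto simp: linear_extension_monomial Pi_iff smult_assoc
          F.smult_assoc[symmetric] A.free_left_module_embedding_closed)
  qed (use \<phi> r in \<open>simp_all add: F.smult_closed F.smult_r_distr smult_closed smult_r_distr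
      linear_extension_add linear_extension_closed\<close>)
qed

section \<open>The universal property\<close>

text \<open>
  On the monomial \<open>r j x\<close>, applying the coefficientwise operator first gives \<open>P\<^sub>\<omega>(r) \<phi>(x)\<close>, and
  applying it last gives \<open>q\<^sub>\<omega>(r \<phi>(x))\<close>; these agree because \<open>\<phi>(x)\<close> is a module constant.
\<close>

lemma (in left_rota_baxter_module) linear_extension_coefficientwise:
  assumes const: "\<phi> ` X \<subseteq> module_constants R \<Omega> P M p" and \<omega>: "\<omega> \<in> \<Omega>"
    and f: "f \<in> carrier (free_left_module R X)"
  shows "linear_extension R X M \<phi> (coefficientwise X P \<omega> f) = p \<omega> (linear_extension R X M \<phi> f)"
proof -
  have \<phi>: "\<phi> \<in> X \<rightarrow> carrier M"
    using const by (auto simp: module_constants_def)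
  have p_closed: "p \<omega> m \<in> carrier M" if "m \<in> carrier M" for m
    using p_linear[OF \<omega>] that by (auto simp: linear_operator_def restrict_scalars_def)
  have p_add: "p \<omega> (m \<oplus>\<^bsub>M\<^esub> n) = p \<omega> m \<oplus>\<^bsub>M\<^esub> p \<omega> n"
    if "m \<in> carrier M" "n \<in> carrier M" for m n
    using p_linear[OF \<omega>] that by (auto simp: linear_operator_def restrict_scalars_def)
  show ?thesis
  proof (rule A.additive_maps_eqI[OF M.M.abelian_group_axioms _ _ _ _ _ f])
    fix r x assume "r \<in> carrier R" "x \<in> X"
    then show "linear_extension R X M \<phi> (coefficientwise X P \<omega>
          (r \<odot>\<^bsub>free_left_module R X\<^esub> free_left_module_embedding R X x)) =
        p \<omega> (linear_extension R X M \<phi>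
          (r \<odot>\<^bsub>free_left_module R X\<^esub> free_left_module_embedding R X x))"
      using const \<phi> \<omega>
      by (auto simp: coefficientwise_monomial M.linear_extension_monomial P_closed
          module_constants_def)
  qed (use \<phi> \<omega> in \<open>simp_all add: coefficientwise_closed coefficientwise_add
      M.linear_extension_add M.linear_extension_closed p_closed p_add\<close>)
qed

lemma (in left_rota_baxter_module) linear_extension_hom:
  assumes const: "\<phi> ` X \<subseteq> module_constants R \<Omega> P M p"
  shows "linear_extension R X M \<phi> \<in>
    rota_baxter_module_hom R \<Omega> (free_left_module R X) (coefficientwise X P) M p"
proof -
  have "\<phi> \<in> X \<rightarrow> carrier M"
    using const by (auto simp: module_constants_def)
  then show ?thesis
    using linear_extension_coefficientwise[OF const]
    by (simp add: rota_baxter_module_hom_def M.linear_extension_closed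
        M.linear_extension_add M.linear_extension_smult)
qed

lemma (in left_module) linear_extension_embedding:
  assumes "\<phi> \<in> X \<rightarrow> carrier M" "x \<in> X"
  shows "linear_extension R X M \<phi> (free_left_module_embedding R X x) = \<phi> x"
proof -
  interpret F: left_module R "free_left_module R X" by (rule A.free_left_module_left_module)
  show ?thesis
    using linear_extension_monomial[OF assms(1) A.one_closed assms(2)] assms
    by (simp add: F.smult_one A.free_left_module_embedding_closed smult_one Pi_iff)
qed

lemma (in left_module) module_hom_eq_on_embedding:
  assumes "g \<in> rota_baxter_module_hom R \<Omega> (free_left_module R X) p M q"
    and "h \<in> rota_baxter_module_hom R \<Omega> (free_left_module R X) p M q"
    and "g \<in> extensional (carrier (free_left_module R X))"
    and "h \<in> extensional (carrier (free_left_module R X))"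
    and "\<And>x. x \<in> X \<Longrightarrow>
      g (free_left_module_embedding R X x) = h (free_left_module_embedding R X x)"
  shows "g = h"
proof (rule extensionalityI[OF assms(3,4)])
  fix f assume f: "f \<in> carrier (free_left_module R X)"
  show "g f = h f"
  proof (rule A.additive_maps_eqI[where g = g and h = h, OF M.abelian_group_axioms _ _ _ _ _ f])
    fix r x assume "r \<in> carrier R" "x \<in> X"
    then show "g (r \<odot>\<^bsub>free_left_module R X\<^esub> free_left_module_embedding R X x) =
        h (r \<odot>\<^bsub>free_left_module R X\<^esub> free_left_module_embedding R X x)"
      using assms by (simp add: rota_baxter_module_hom_def A.free_left_module_embedding_closed)
  qed (use assms in \<open>simp_all add: rota_baxter_module_hom_def\<close>)
qed

theorem theorem2p16:
  fixes K :: "('k, 'c) ring_scheme" and R :: "('k, 'r, 'a) module_scheme"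
    and \<Omega> :: "'o set" and w :: "'o \<Rightarrow> 'k" and P :: "'o \<Rightarrow> 'r \<Rightarrow> 'r"
    and X :: "'x set"
  assumes "multiple_rota_baxter_algebra K R \<Omega> w P"
  shows "left_rota_baxter_module K R \<Omega> w P (free_left_module R X) (coefficientwise X P) \<and>
         restricted_free_module TYPE('m) K R \<Omega> w P X
           (free_left_module R X) (coefficientwise X P) (free_left_module_embedding R X)"
proof -
  interpret multiple_rota_baxter_algebra K R \<Omega> w P by (rule assms)
  have universal: "\<exists>!h. h \<in> rota_baxter_module_hom R \<Omega> (free_left_module R X) (coefficientwise X P) M q \<and>
      h \<in> extensional (carrier (free_left_module R X)) \<and>
      (\<forall>x\<in>X. h (free_left_module_embedding R X x) = \<phi> x)"
    if "left_rota_baxter_module K R \<Omega> w P M q" "\<phi> \<in> X \<rightarrow> carrier M"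
      "\<phi> ` X \<subseteq> module_constants R \<Omega> P M q"
    for M :: "('r, 'm) module" and q \<phi>
  proof -
    interpret N: left_rota_baxter_module K R \<Omega> w P M q by (rule that(1))
    note extension_hom = N.linear_extension_hom[OF that(3)]
    have extensional: "linear_extension R X M \<phi> \<in> extensional (carrier (free_left_module R X))"
      by (simp add: linear_extension_def)
    have on_basis: "linear_extension R X M \<phi> (free_left_module_embedding R X x) = \<phi> x"
      if "x \<in> X" for x
      using \<open>\<phi> \<in> X \<rightarrow> carrier M\<close> that by (rule N.M.linear_extension_embedding)
    show ?thesis
    proof (intro ex1I[of _ "linear_extension R X M \<phi>"] conjI ballI)
      fix h
      assume h: "h \<in> rota_baxter_module_hom R \<Omega> (free_left_module R X) (coefficientwise X P) M q \<and>
        h \<in> extensional (carrier (free_left_module R X)) \<and>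
        (\<forall>x\<in>X. h (free_left_module_embedding R X x) = \<phi> x)"
      show "h = linear_extension R X M \<phi>"
        by (rule N.M.module_hom_eq_on_embedding[OF _ extension_hom _ extensional])
          (use h on_basis in simp_all)
    qed (fact extension_hom extensional on_basis)+
  qed
  have "free_left_module_embedding R X \<in> X \<rightarrow> carrier (free_left_module R X)"
    by (simp add: A.free_left_module_embedding_closed)
  then show ?thesis
    unfolding restricted_free_module_def
    using free_left_rota_baxter_module universal by blast
qed

end
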